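(* Let $X=\{x_1,\ldots,x_n\}$ and let $I\subset\mathbb{Z}[X]$ be a monomial ideal containing $x_1^2,\ldots,x_n^2$ which is spherical. Then all resolutions of $I$ are spherical, all maximal resolutions of $I$ have the same depth, and $I$ has a unique core up to permutation of the variables (i.e. for any two maximal resolutions $A,A'$ there is a permutation $\sigma$ of the variables with $c(A)=\sigma(c(A'))$).
   Context: $R(I)$ denotes the simplicial complex of monomials not in $I$. $(I:x)=\{m:xm\in I\}$. $R(I)$ is a cone with apex $a\in X$ if $(I:a)=(I,a)$, i.e. $a$ divides no minimal monomial generator of $I$ other than the $x_i^2$. For $a,b\in X$, $a$ dominates $b$ in $I$ if $R(I)$ is not a cone with apex $b$ but $R((I,a))$ is a cone with apex $b$. For a sequence $A=(a_1,\ldots,a_r)$ of variables let $I_i=(I:a_1\cdots a_{i-1})$, $i\in[r+1]$. $A$ is a resolution of $I$ if for every $i\in[r]$, $a_i\notin I_i$ and either $R(I_i)$ is a cone with apex $a_i$ or there is $b_i\in X$ such that $a_i$ dominates $b_i$ in $I_i$. A resolution is maximal if it cannot be extended by appending a further variable to a resolution. The core of $A$ is $c(A)=I_{r+1}$, the depth is $d(A)=r$. $A$ is spherical if $R(I_i)$ is not a cone with apex $a_i$ for every $i\in[r]$. The ideal $I$ is spherical if it admits a maximal resolution which is spherical. *)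

theory Defs
  imports Complex_Main "HOL-Library.Poly_Mapping"
begin

text \<open>
  The ring \<open>\<int>[X]\<close> is the monoid algebra over \<open>int\<close> of exponent vectors \<^typ>\<open>'x \<Rightarrow>\<^sub>0 nat\<close>, where
  the elements of \<^typ>\<open>'x\<close> index the variables.
\<close>

type_synonym 'x mon = "'x \<Rightarrow>\<^sub>0 nat"
type_synonym 'x zpoly = "'x mon \<Rightarrow>\<^sub>0 int"

definition monom :: "'x mon \<Rightarrow> 'x zpoly" where
  "monom m = Poly_Mapping.single m 1"

definition var :: "'x \<Rightarrow> 'x zpoly" where
  "var x = monom (Poly_Mapping.single x 1)"

text \<open>Ideals are the submodules of the ring regarded as a module over itself.\<close>

definition ideal_gen :: "'x zpoly set \<Rightarrow> 'x zpoly set" where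
  "ideal_gen S = module.span (*) S"

definition monomial_ideal :: "'x zpoly set \<Rightarrow> bool" where
  "monomial_ideal I \<longleftrightarrow> (\<exists>M. I = ideal_gen (monom ` M))"

definition colon :: "'x zpoly set \<Rightarrow> 'x zpoly \<Rightarrow> 'x zpoly set" where
  "colon I f = {p. f * p \<in> I}"

definition adjoin :: "'x zpoly set \<Rightarrow> 'x zpoly \<Rightarrow> 'x zpoly set" where
  "adjoin I f = ideal_gen (insert f I)"

text \<open>
  \<open>cone_apex I a\<close>: the simplicial complex \<open>R(I)\<close> of monomials not in \<open>I\<close> is a cone with apex \<open>a\<close>,
  which by definition means \<open>(I : a) = (I, a)\<close>.
\<close>

definition cone_apex :: "'x zpoly set \<Rightarrow> 'x \<Rightarrow> bool" where
  "cone_apex I a \<longleftrightarrow> colon I (var a) = adjoin I (var a)"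

definition dominates :: "'x zpoly set \<Rightarrow> 'x \<Rightarrow> 'x \<Rightarrow> bool" where
  "dominates I a b \<longleftrightarrow> \<not> cone_apex I b \<and> cone_apex (adjoin I (var a)) b"

text \<open>
  Sequences of variables are lists, indexed from 0: for \<open>A = [a\<^sub>1, \<dots>, a\<^sub>r]\<close> the ideal
  \<open>I\<^sub>i = (I : a\<^sub>1 \<cdots> a\<^bsub>i-1\<^esub>)\<close> is \<open>stage I A (i - 1)\<close>.
\<close>

definition stage :: "'x zpoly set \<Rightarrow> 'x list \<Rightarrow> nat \<Rightarrow> 'x zpoly set" where
  "stage I A i = colon I (prod_list (map var (take i A)))"

definition resolution :: "'x zpoly set \<Rightarrow> 'x list \<Rightarrow> bool" where
  "resolution I A \<longleftrightarrow>
     (\<forall>i<length A. var (A ! i) \<notin> stage I A i \<and>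
        (cone_apex (stage I A i) (A ! i) \<or> (\<exists>b. dominates (stage I A i) (A ! i) b)))"

definition maximal_resolution :: "'x zpoly set \<Rightarrow> 'x list \<Rightarrow> bool" where
  "maximal_resolution I A \<longleftrightarrow> resolution I A \<and> (\<forall>a. \<not> resolution I (A @ [a]))"

definition core :: "'x zpoly set \<Rightarrow> 'x list \<Rightarrow> 'x zpoly set" where
  "core I A = stage I A (length A)"

definition depth :: "'x list \<Rightarrow> nat" where
  "depth A = length A"

definition spherical_resolution :: "'x zpoly set \<Rightarrow> 'x list \<Rightarrow> bool" where
  "spherical_resolution I A \<longleftrightarrow>
     resolution I A \<and> (\<forall>i<length A. \<not> cone_apex (stage I A i) (A ! i))"

definition spherical_ideal :: "'x zpoly set \<Rightarrow> bool" where
  "spherical_ideal I \<longleftrightarrow> (\<exists>A. maximal_resolution I A \<and> spherical_resolution I A)"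

text \<open>
  The action of a permutation \<open>\<sigma>\<close> of the variables on polynomials, \<open>x \<mapsto> \<sigma> x\<close>. The coefficient of
  \<open>m\<close> in \<open>permute_vars \<sigma> p\<close> is that of \<open>m \<circ> \<sigma>\<close> in \<open>p\<close>; see the lemmas below for the direction.
\<close>

definition permute_vars :: "('x \<Rightarrow> 'x) \<Rightarrow> 'x zpoly \<Rightarrow> 'x zpoly" where
  "permute_vars \<sigma> p = Poly_Mapping.map_key (Poly_Mapping.map_key \<sigma>) p"

lemma inj_map_key_bij:
  assumes "bij \<sigma>"
  shows "inj (Poly_Mapping.map_key \<sigma> :: 'x mon \<Rightarrow> 'x mon)"
proof (rule injI)
  fix m m' :: "'x mon"
  assume eq: "Poly_Mapping.map_key \<sigma> m = Poly_Mapping.map_key \<sigma> m'"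
  have "Poly_Mapping.lookup m (\<sigma> x) = Poly_Mapping.lookup m' (\<sigma> x)" for x
    using arg_cong[OF eq, of "\<lambda>k. Poly_Mapping.lookup k x"] assms
    by (simp add: map_key.rep_eq bij_is_inj)
  then have "Poly_Mapping.lookup m y = Poly_Mapping.lookup m' y" for y
    using assms by (metis bij_pointE)
  then show "m = m'"
    by (simp add: poly_mapping_eqI)
qed

lemma permute_vars_single:
  assumes "bij \<sigma>"
  shows "permute_vars \<sigma> (Poly_Mapping.single m c) =
    Poly_Mapping.single (Poly_Mapping.map_key (inv \<sigma>) m) c"
proof -
  have "Poly_Mapping.map_key \<sigma> (Poly_Mapping.map_key (inv \<sigma>) m) = m"
    using assms by (simp add: map_key_compose bij_is_inj bij_imp_bij_inv map_key_id[unfolded id_def[symmetric]])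
  then show ?thesis
    unfolding permute_vars_def
    by (metis map_key_single[OF inj_map_key_bij[OF assms]])
qed

lemma permute_vars_var:
  assumes "bij \<sigma>"
  shows "permute_vars \<sigma> (var x) = var (\<sigma> x)"
proof -
  have "Poly_Mapping.map_key (inv \<sigma>) (Poly_Mapping.single x (1::nat)) = Poly_Mapping.single (\<sigma> x) 1"
    using map_key_single[of "inv \<sigma>" "\<sigma> x" "1::nat"] assms
    by (simp add: bij_is_inj bij_imp_bij_inv)
  then show ?thesis
    by (simp add: var_def monom_def permute_vars_single[OF assms])
qed

lemma permute_vars_plus:
  assumes "bij \<sigma>"
  shows "permute_vars \<sigma> (p + q) = permute_vars \<sigma> p + permute_vars \<sigma> q"
  unfolding permute_vars_def by (rule map_key_plus[OF inj_map_key_bij[OF assms]])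

end

theory Submission
  imports Defs "HOL-Combinatorics.Transposition"
begin

text \<open>
  An ideal as in the theorem is determined by the up-closed family of the non-faces of \<open>R(I)\<close>;
  \<open>(I : a)\<close> corresponds to the link of \<open>a\<close> and \<open>(I, a)\<close> to its deletion. The theorem is a diamond
  argument, by induction on the length of a spherical maximal resolution that starts with \<open>a\<close>.
  Let \<open>a\<close> dominate \<open>b\<close>, and let \<open>c \<noteq> a\<close> be another possible first variable. It is not a cone apex,
  since it would stay one in the link of \<open>a\<close>; so it dominates some \<open>d\<close>. Domination is transitive,
  so either \<open>b \<noteq> c\<close> and \<open>d \<noteq> a\<close> can be arranged, or \<open>a\<close> and \<open>c\<close> dominate each other. In the
  latter case the transposition of \<open>a\<close> and \<open>c\<close> is a symmetry which identifies the two links. In the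
  former, \<open>c\<close> can be resolved after \<open>a\<close> and \<open>a\<close> after \<open>c\<close>, since otherwise \<open>d\<close> or \<open>b\<close> would become
  a cone apex, which the induction hypothesis excludes; both orders lead to the same iterated link.
\<close>

section \<open>Families of non-faces\<close>

definition up_closed :: "'x set set \<Rightarrow> bool" where
  "up_closed N \<longleftrightarrow> (\<forall>F\<in>N. \<forall>G. F \<subseteq> G \<longrightarrow> G \<in> N)"

lemma up_closedD: "up_closed N \<Longrightarrow> F \<in> N \<Longrightarrow> F \<subseteq> G \<Longrightarrow> G \<in> N"
  by (auto simp: up_closed_def)

text \<open>For up-closed \<open>N\<close> this amounts to
  \<open>link N a = {F. a \<in> F \<or> F \<in> N}\<close>, the form that (I : a) = (I, a) takes on
  families.\<close>

definition cone :: "'x set set \<Rightarrow> 'x \<Rightarrow> bool" where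
  "cone N a \<longleftrightarrow> (\<forall>F. insert a F \<in> N \<longrightarrow> F \<in> N)"

text \<open>For \<open>a \<noteq> b\<close> the last conjunct makes \<open>b\<close> a cone apex of
  the deletion \<open>{F. a \<in> F \<or> F \<in> N}\<close>.\<close>

definition dominating :: "'x set set \<Rightarrow> 'x \<Rightarrow> 'x \<Rightarrow> bool" where
  "dominating N a b \<longleftrightarrow> \<not> cone N b \<and> a \<noteq> b \<and> (\<forall>F. a \<notin> F \<longrightarrow> insert b F \<in> N \<longrightarrow> F \<in> N)"

text \<open>Faces of the link avoid \<open>a\<close>, whence the first disjunct.\<close>

definition link :: "'x set set \<Rightarrow> 'x \<Rightarrow> 'x set set" where
  "link N a = {F. a \<in> F \<or> insert a F \<in> N}"

definition step :: "'x set set \<Rightarrow> 'x \<Rightarrow> bool" where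
  "step N a \<longleftrightarrow> {a} \<notin> N \<and> (cone N a \<or> (\<exists>b. dominating N a b))"

text \<open>Recursion along links, here and in the next two functions, makes splitting off the first
  variable an induction step.\<close>

fun res :: "'x set set \<Rightarrow> 'x list \<Rightarrow> bool" where
  "res N [] \<longleftrightarrow> True"
| "res N (a # A) \<longleftrightarrow> step N a \<and> res (link N a) A"

fun cone_free :: "'x set set \<Rightarrow> 'x list \<Rightarrow> bool" where
  "cone_free N [] \<longleftrightarrow> True"
| "cone_free N (a # A) \<longleftrightarrow> \<not> cone N a \<and> cone_free (link N a) A"

fun max_res :: "'x set set \<Rightarrow> 'x list \<Rightarrow> bool" where
  "max_res N [] \<longleftrightarrow> (\<forall>a. \<not> step N a)"
| "max_res N (a # A) \<longleftrightarrow> step N a \<and> max_res (link N a) A"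

abbreviation links :: "'x set set \<Rightarrow> 'x list \<Rightarrow> 'x set set" where
  "links \<equiv> foldl link"

lemma max_res_imp_res: "max_res N A \<Longrightarrow> res N A"
  by (induction N A rule: max_res.induct) auto

section \<open>Links, cones and domination\<close>

lemma up_closed_link: "up_closed N \<Longrightarrow> up_closed (link N a)"
  unfolding up_closed_def link_def by (blast intro: insert_mono)

lemma link_commute: "link (link N a) c = link (link N c) a"
  by (auto simp: link_def insert_commute)

lemma cone_link: "cone N d \<Longrightarrow> d \<noteq> a \<Longrightarrow> cone (link N a) d"
  unfolding cone_def link_def by (auto simp: insert_commute)

text \<open>The condition for \<open>F\<close> in the link is the old one for
  \<open>insert a F\<close>, which still avoids \<open>c\<close>. Only the clause that
  \<open>d\<close> is no apex can get lost, hence the disjunction.\<close>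

lemma dom_link:
  assumes "dominating N c d" "d \<noteq> a" "c \<noteq> a"
  shows "cone (link N a) d \<or> dominating (link N a) c d"
proof -
  have "F \<in> link N a" if "c \<notin> F" "insert d F \<in> link N a" for F
  proof (cases "a \<in> F")
    case False
    with that assms have "insert d (insert a F) \<in> N" "c \<notin> insert a F"
      by (auto simp: link_def insert_commute)
    with assms(1) show ?thesis by (auto simp: dominating_def link_def)
  qed (simp add: link_def)
  with assms(1) show ?thesis by (auto simp: dominating_def)
qed

text \<open>If \<open>{c}\<close> were a non-face, so would be every set containing
  \<open>c\<close>; domination handles the other sets, and \<open>d\<close> would be an
  apex.\<close>

lemma dom_vertex:
  assumes "up_closed N" "dominating N c d"
  shows "{c} \<notin> N"
proof
  assume c: "{c} \<in> N"
  have "F \<in> N" if "insert d F \<in> N" for F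
  proof (cases "c \<in> F")
    case True
    then show ?thesis using up_closedD[OF assms(1) c, of F] by blast
  next
    case False
    then show ?thesis using that assms(2) unfolding dominating_def by blast
  qed
  then have "cone N d" unfolding cone_def by blast
  with assms(2) show False unfolding dominating_def by blast
qed

text \<open>If \<open>a\<close> were an apex, it could be removed from a non-face, then
  \<open>b\<close> by domination, and \<open>a\<close> put back by up-closure; so \<open>b\<close>
  would be an apex.\<close>

lemma dom_not_cone:
  assumes "up_closed N" "dominating N a b"
  shows "\<not> cone N a"
proof
  assume a: "cone N a"
  have "F \<in> N" if "insert b F \<in> N" for F
  proof -
    have "insert a (insert b (F - {a})) \<in> N"
      by (rule up_closedD[OF assms(1) that]) blast
    with a have "insert b (F - {a}) \<in> N" unfolding cone_def by blast
    with assms(2) have "F - {a} \<in> N" unfolding dominating_def by blast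
    then show ?thesis by (rule up_closedD[OF assms(1)]) blast
  qed
  then have "cone N b" unfolding cone_def by blast
  with assms(2) show False unfolding dominating_def by blast
qed

lemma dom_irrefl: "dominating N a b \<Longrightarrow> b \<noteq> a"
  by (auto simp only: dominating_def)

text \<open>When \<open>a\<close> lies in \<open>F\<close>, first \<open>a\<close> is dropped while
  \<open>b\<close> is present, then \<open>b\<close>, and up-closure restores
  \<open>a\<close>.\<close>

lemma dom_trans:
  assumes "up_closed N" "dominating N c a" "dominating N a b" "b \<noteq> c"
  shows "dominating N c b"
proof -
  have "F \<in> N" if F: "c \<notin> F" "insert b F \<in> N" for F
  proof (cases "a \<in> F")
    case True
    define G where "G = F - {a}"
    have G: "F = insert a G" "a \<notin> G" using True by (auto simp: G_def)
    have "insert a (insert b G) \<in> N" using F G by (simp add: insert_commute)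
    moreover have "c \<notin> insert b G" using F assms(4) G by auto
    ultimately have "insert b G \<in> N" using assms(2) by (simp add: dominating_def)
    then have "G \<in> N" using assms(3) G by (simp add: dominating_def)
    then show ?thesis using up_closedD[OF assms(1)] G(1) by blast
  qed (use F assms(3) in \<open>simp add: dominating_def\<close>)
  moreover have "\<not> cone N b" using assms(3) by (simp only: dominating_def simp_thms)
  ultimately show ?thesis using assms(4) unfolding dominating_def by blast
qed

lemma cone_step: "cone N d \<Longrightarrow> {d} \<notin> N \<Longrightarrow> step N d"
  by (simp add: step_def)

lemma dom_step: "up_closed N \<Longrightarrow> dominating N a b \<Longrightarrow> step N a"
  using dom_vertex[of N a b] unfolding step_def by blast

lemma max_res_exists:
  fixes N :: "'x::finite set set"
  assumes "up_closed N"
  shows "\<exists>A. max_res N A"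
  using assms
proof (induction "card {x. {x} \<notin> N}" arbitrary: N rule: less_induct)
  case less
  show ?case
  proof (cases "\<exists>a. step N a")
    case True
    then obtain a where a: "step N a" by blast
    \<comment> \<open>Passing to the link of a vertex loses at least that vertex, so the process
      terminates.\<close>
    have "{x. {x} \<notin> link N a} \<subseteq> {x. {x} \<notin> N}"
      using up_closedD[OF less.prems] by (fastforce simp: link_def)
    moreover have "a \<in> {x. {x} \<notin> N}" "a \<notin> {x. {x} \<notin> link N a}"
      using a by (auto simp: step_def link_def)
    ultimately have "card {x. {x} \<notin> link N a} < card {x. {x} \<notin> N}"
      by (intro psubset_card_mono) auto
    then obtain A where "max_res (link N a) A"
      using less.hyps up_closed_link[OF less.prems] by blast
    with a have "max_res N (a # A)" by simp
    then show ?thesis ..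
  next
    case False
    then have "max_res N []" by simp
    then show ?thesis ..
  qed
qed

section \<open>Permuting the variables\<close>

abbreviation act :: "('x \<Rightarrow> 'x) \<Rightarrow> 'x set set \<Rightarrow> 'x set set" where
  "act \<sigma> N \<equiv> (`) \<sigma> ` N"

context
  fixes \<sigma> :: "'x \<Rightarrow> 'x"
  assumes bij: "bij \<sigma>"
begin

lemma image_mem_act: "\<sigma> ` F \<in> act \<sigma> N \<longleftrightarrow> F \<in> N"
  using bij by (auto simp: inj_image_eq_iff bij_is_inj)

lemma insert_image_mem_act: "insert (\<sigma> a) (\<sigma> ` F) \<in> act \<sigma> N \<longleftrightarrow> insert a F \<in> N"
  by (simp only: image_insert[symmetric] image_mem_act)

text \<open>Every set is an image under the bijection, so the set quantifiers in \<open>cone\<close>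
  and \<open>dominating\<close> can be transported.\<close>

lemma all_sets_image: "(\<forall>F. P F) \<longleftrightarrow> (\<forall>F. P (\<sigma> ` F))"
  by (metis bij bij_is_surj surj_image_vimage_eq)

lemma mem_image_bij: "\<sigma> a \<in> \<sigma> ` F \<longleftrightarrow> a \<in> F"
  using bij by (simp add: inj_image_mem_iff bij_is_inj)

lemma cone_act: "cone (act \<sigma> N) (\<sigma> a) \<longleftrightarrow> cone N a"
  unfolding cone_def
  by (subst all_sets_image) (simp only: insert_image_mem_act image_mem_act)

lemma dom_act: "dominating (act \<sigma> N) (\<sigma> a) (\<sigma> b) \<longleftrightarrow> dominating N a b"
  unfolding dominating_def cone_act
  by (subst all_sets_image)
    (simp only: insert_image_mem_act image_mem_act mem_image_bij inj_eq[OF bij_is_inj[OF bij]])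

lemma step_act: "step (act \<sigma> N) (\<sigma> a) \<longleftrightarrow> step N a"
proof -
  have "(\<exists>b. dominating (act \<sigma> N) (\<sigma> a) b) \<longleftrightarrow> (\<exists>b. dominating N a b)"
    by (metis dom_act bij bij_pointE)
  moreover have "{\<sigma> a} \<in> act \<sigma> N \<longleftrightarrow> {a} \<in> N"
    using image_mem_act[of "{a}"] by simp
  ultimately show ?thesis by (simp add: step_def cone_act)
qed

lemma link_act: "link (act \<sigma> N) (\<sigma> a) = act \<sigma> (link N a)"
proof -
  have "\<forall>F. F \<in> link (act \<sigma> N) (\<sigma> a) \<longleftrightarrow> F \<in> act \<sigma> (link N a)"
    by (subst all_sets_image)
      (simp only: link_def image_mem_act mem_Collect_eq mem_image_bij insert_image_mem_act simp_thms)
  then show ?thesis by blast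
qed

lemma max_res_act: "max_res N A \<Longrightarrow> max_res (act \<sigma> N) (map \<sigma> A)"
proof (induction A arbitrary: N)
  case Nil
  then show ?case by simp (metis step_act bij bij_pointE)
qed (simp add: step_act link_act)

lemma cone_free_act: "cone_free N A \<Longrightarrow> cone_free (act \<sigma> N) (map \<sigma> A)"
  by (induction A arbitrary: N) (simp_all add: cone_act link_act)

lemma links_act: "links (act \<sigma> N) (map \<sigma> A) = act \<sigma> (links N A)"
  by (induction A arbitrary: N) (simp_all add: link_act)

end

lemma act_comp: "act \<sigma> (act \<tau> N) = act (\<sigma> \<circ> \<tau>) N"
  by (simp add: image_comp comp_def)

text \<open>If a non-face contains exactly one of \<open>a\<close> and \<open>c\<close>, domination
  by the other allows dropping it, and the swapped set contains what remains. The reverse inclusion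
  holds since the transposition is an involution.\<close>

lemma mutual_dom_swap:
  assumes "up_closed N" "dominating N a c" "dominating N c a"
  shows "act (transpose a c) N = N"
proof -
  let ?\<tau> = "transpose a c"
  have *: "?\<tau> ` F \<in> N" if "F \<in> N" for F
  proof -
    consider "a \<in> F \<longleftrightarrow> c \<in> F" | "a \<in> F" "c \<notin> F" | "a \<notin> F" "c \<in> F" by blast
    then show ?thesis
    proof cases
      case 1
      then have "?\<tau> ` F = F" by (cases "a \<in> F") auto
      with that show ?thesis by simp
    next
      case 2
      then have F: "insert a (F - {a}) = F" by auto
      then have "F - {a} \<in> N" using 2 that assms(3) by (simp add: dominating_def)
      moreover have "F - {a} \<subseteq> ?\<tau> ` F"
        using 2 by (force simp: image_iff transpose_def)
      ultimately show ?thesis using up_closedD[OF assms(1)] by blast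
    next
      case 3
      then have F: "insert c (F - {c}) = F" by auto
      then have "F - {c} \<in> N" using 3 that assms(2) by (simp add: dominating_def)
      moreover have "F - {c} \<subseteq> ?\<tau> ` F"
        using 3 by (force simp: image_iff transpose_def)
      ultimately show ?thesis using up_closedD[OF assms(1)] by blast
    qed
  qed
  have "F \<in> act ?\<tau> N" if "F \<in> N" for F
  proof
    show "F = ?\<tau> ` ?\<tau> ` F" by (simp add: image_comp)
    show "?\<tau> ` F \<in> N" using that by (rule *)
  qed
  with * show ?thesis by blast
qed

section \<open>The diamond argument\<close>

text \<open>Cone-freeness is assumed for the link of \<open>a\<close> only, as the induction will
  supply it. The clause on \<open>link N c\<close> ensures that continuing there with
  \<open>a\<close> is again spherical.\<close>

lemma diamond:
  assumes up: "up_closed N"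
    and a: "dominating N a b" and c: "step N c" "c \<noteq> a"
    and sph: "\<And>A. res (link N a) A \<Longrightarrow> cone_free (link N a) A"
  shows "\<not> cone N c"
    and "(step (link N a) c \<and> step (link N c) a \<and> \<not> cone (link N c) a) \<or>
         (dominating N a c \<and> dominating N c a)"
proof -
  \<comment> \<open>An apex that is a vertex of the link would by itself be a resolution of length
    one violating \<open>sph\<close>.\<close>
  have no_cone: "\<not> cone (link N a) x" if "{x} \<notin> link N a" for x
    using sph[of "[x]"] that by (auto simp: step_def)
  have va: "{a} \<notin> N" using dom_vertex[OF up a] .
  have vc: "{c} \<notin> N" using c by (simp add: step_def)
  show nc: "\<not> cone N c"
  proof
    assume cc: "cone N c"
    have "{c} \<notin> link N a"
      using cc va c by (auto simp: link_def cone_def insert_commute)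
    with no_cone cone_link[OF cc c(2)] show False by blast
  qed
  then obtain d where d: "dominating N c d" using c by (auto simp: step_def)
  show "(step (link N a) c \<and> step (link N c) a \<and> \<not> cone (link N c) a) \<or>
        (dominating N a c \<and> dominating N c a)"
  proof (rule disjCI)
    assume nm: "\<not> (dominating N a c \<and> dominating N c a)"
    \<comment> \<open>If \<open>c\<close> dominates \<open>a\<close>, transitivity replaces
      \<open>a\<close> by \<open>b\<close>; \<open>b = c\<close> would be mutual domination. The
      choice of \<open>b\<close> below is symmetric.\<close>
    obtain d where d: "dominating N c d" "d \<noteq> a"
    proof (cases "d = a")
      case True
      then have "b \<noteq> c" using a d nm by blast
      then have "dominating N c b" using dom_trans[OF up _ a] d True by blast
      then show thesis using that dom_irrefl[OF a] by blast
    qed (use that d in blast)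
    obtain b where b: "dominating N a b" "b \<noteq> c"
    proof (cases "b = c")
      case True
      then have "dominating N a d" using dom_trans[OF up _ d(1,2)] a by blast
      then show thesis using that dom_irrefl[OF d(1)] by blast
    qed (use that a in blast)
    note upa = up_closed_link[OF up, of a] and upc = up_closed_link[OF up, of c]
    \<comment> \<open>\<open>{a, d}\<close> is a face: otherwise domination applied to
      \<open>{a}\<close>, which avoids \<open>c\<close>, would make \<open>{a}\<close> a non-face.
      Hence \<open>d\<close> cannot become an apex of the link.\<close>
    have "{d} \<notin> link N a"
      using d va c by (auto simp: link_def dominating_def insert_commute)
    with dom_link[OF d(1,2) c(2)] no_cone have ca: "dominating (link N a) c d" by blast
    have "{a, c} \<notin> N"
      using dom_vertex[OF upa ca] by (auto simp: link_def)
    \<comment> \<open>An apex \<open>b\<close> here would remain one, and a vertex, in the double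
      link, so \<open>[c, b]\<close> would be a resolution of \<open>link N a\<close> that is not
      cone-free.\<close>
    have "\<not> cone (link N c) b"
    proof
      assume cb: "cone (link N c) b"
      have ba: "b \<noteq> a" using dom_irrefl[OF b(1)] .
      have cone': "cone (link (link N a) c) b"
        using cone_link[OF cb ba] by (simp add: link_commute)
      have "{b} \<notin> link (link N a) c"
      proof
        assume "{b} \<in> link (link N a) c"
        then have "insert b {a} \<in> link N c"
          using b ba c by (auto simp: link_def insert_commute)
        with cb have "{a} \<in> link N c" by (simp add: cone_def)
        with \<open>{a, c} \<notin> N\<close> c show False by (auto simp: link_def insert_commute)
      qed
      with cone' dom_step[OF upa ca] have "res (link N a) [c, b]"
        by (simp add: cone_step)
      from sph[OF this] cone' show False by simp
    qed
    with dom_link[OF b(1,2)] c have ac: "dominating (link N c) a b" by blast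
    show "step (link N a) c \<and> step (link N c) a \<and> \<not> cone (link N c) a"
      using dom_step[OF upa ca] dom_step[OF upc ac] dom_not_cone[OF upc ac] by simp
  qed
qed

text \<open>Both claims are proved at once, because the first one for \<open>link N a\<close> is the
  assumption \<open>sph\<close> of \<open>diamond\<close>.\<close>

lemma spherical_confluence:
  fixes N :: "'x::finite set set"
  assumes "up_closed N" "max_res N A" "cone_free N A"
  shows "(res N B \<longrightarrow> cone_free N B) \<and>
    (max_res N B \<longrightarrow> length B = length A \<and> (\<exists>\<sigma>. bij \<sigma> \<and> links N B = act \<sigma> (links N A)))"
  using assms
proof (induction "length A" arbitrary: N A B)
  case 0
  then have A: "A = []" "\<And>x. \<not> step N x" by auto
  then show ?case
    by (cases B) (auto intro!: exI[of _ id])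
next
  case (Suc n)
  from Suc.hyps(2) obtain a T where A: "A = a # T" "length T = n" by (cases A) auto
  note up = \<open>up_closed N\<close>
  have T: "max_res (link N a) T" "cone_free (link N a) T" and a: "step N a" "\<not> cone N a"
    using Suc.prems A by auto
  obtain b where b: "dominating N a b" using a by (auto simp: step_def)
  note IH = Suc.hyps(1)[OF _ up_closed_link[OF up]]
  show ?case
  proof (cases "\<exists>c S. B = c # S \<and> step N c")
    \<comment> \<open>Either \<open>B\<close> is empty, hence not maximal because of
      \<open>a\<close>, or its first step is invalid.\<close>
    case False
    then show ?thesis using a by (cases B) auto
  next
    case True
    then obtain c S where B: "B = c # S" and c: "step N c" by blast
    \<comment> \<open>A spherical maximal resolution of \<open>link N c\<close> as long as
      \<open>T\<close> makes the induction hypothesis available below \<open>c\<close> as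
      well.\<close>
    have "\<exists>T'. length T' = n \<and> max_res (link N c) T' \<and> cone_free (link N c) T' \<and> \<not> cone N c \<and>
      (\<exists>\<sigma>. bij \<sigma> \<and> links (link N c) T' = act \<sigma> (links (link N a) T))"
    proof (cases "c = a")
      case True
      have "links (link N a) T = act id (links (link N a) T)" by simp
      then show ?thesis using True A T a bij_id by blast
    next
      case False
      have sph: "cone_free (link N a) C" if "res (link N a) C" for C
        using IH[OF A(2)[symmetric] T] that by blast
      have dia: "\<not> cone N c"
        "(step (link N a) c \<and> step (link N c) a \<and> \<not> cone (link N c) a) \<or>
         (dominating N a c \<and> dominating N c a)"
        using diamond[OF up b c False] sph by blast+
      from dia(2) show ?thesis
      proof (elim disjE conjE)
        assume mutual: "dominating N a c" "dominating N c a"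
        let ?\<tau> = "transpose a c"
        have bij: "bij ?\<tau>" by simp
        have "link N c = act ?\<tau> (link N a)"
          using link_act[OF bij, of N a] mutual_dom_swap[OF up mutual] by simp
        then show ?thesis
          using max_res_act[OF bij T(1)] cone_free_act[OF bij T(2)] links_act[OF bij] A(2)
            dia(1) bij length_map by metis
      next
        assume ca: "step (link N a) c" "step (link N c) a" "\<not> cone (link N c) a"
        \<comment> \<open>One completion \<open>R\<close> serves both orders, as the double links
          agree. The induction hypothesis at \<open>link N a\<close> fixes its length and its
          core.\<close>
        obtain R where R: "max_res (link (link N a) c) R"
          using max_res_exists up_closed_link up by metis
        then have mR: "max_res (link N a) (c # R)" using ca by simp
        note R' = IH[OF A(2)[symmetric] T, of "c # R"]
        have "cone_free (link N a) (c # R)" using sph max_res_imp_res[OF mR] .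
        then have "cone_free (link N c) (a # R)" "max_res (link N c) (a # R)"
          using ca R by (simp_all add: link_commute)
        moreover have "length (a # R) = n" using R' mR A by simp
        moreover have "links (link N c) (a # R) = links (link N a) (c # R)"
          by (simp add: link_commute)
        ultimately show ?thesis using R' mR dia(1) by metis
      qed
    qed
    then obtain T' \<sigma> where T': "length T' = n" "max_res (link N c) T'" "cone_free (link N c) T'"
      "\<not> cone N c" "bij \<sigma>" "links (link N c) T' = act \<sigma> (links (link N a) T)"
      by blast
    note S = IH[OF T'(1)[symmetric] T'(2,3), of S]
    show ?thesis
    proof (intro conjI impI)
      show "cone_free N B" if "res N B" using that S B T'(4) by simp
      assume mB: "max_res N B"
      then have mS: "max_res (link N c) S" using B by simp
      then show "length B = length A" using S B A T'(1) by simp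
      obtain \<rho> where \<rho>: "bij \<rho>" "links (link N c) S = act \<rho> (links (link N c) T')"
        using S mS by blast
      then have "links N B = act (\<rho> \<circ> \<sigma>) (links N A)"
        using B A T' by (simp add: act_comp)
      with \<rho>(1) T'(5) show "\<exists>\<sigma>. bij \<sigma> \<and> links N B = act \<sigma> (links N A)"
        using bij_comp by blast
    qed
  qed
qed

section \<open>Monomial ideals\<close>

lemma module_zpoly: "module ((*) :: 'x zpoly \<Rightarrow> _)"
  by standard (simp_all add: algebra_simps)

section \<open>Supports of polynomials in monomial ideals\<close>

lemma keys_add_nat: "Poly_Mapping.keys (s + t :: 'x mon) = Poly_Mapping.keys s \<union> Poly_Mapping.keys t"
  by (auto simp: in_keys_iff lookup_add)

lemma poly_sum_single:
  "p = (\<Sum>m\<in>Poly_Mapping.keys p. Poly_Mapping.single m (Poly_Mapping.lookup p m))"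
  by (rule poly_mapping_eqI)
    (simp add: lookup_sum lookup_single when_def sum.delta in_keys_iff)

text \<open>Multiplication by a monomial shifts exponents injectively, so no terms cancel.\<close>

lemma keys_single_mult:
  fixes p :: "'x zpoly"
  shows "Poly_Mapping.keys (Poly_Mapping.single t 1 * p) = (+) t ` Poly_Mapping.keys p"
proof -
  have "Poly_Mapping.single t 1 * p =
      (\<Sum>m\<in>Poly_Mapping.keys p. Poly_Mapping.single (t + m) (Poly_Mapping.lookup p m))"
    by (subst (1) poly_sum_single[of p]) (simp add: sum_distrib_left mult_single)
  then have "Poly_Mapping.lookup (Poly_Mapping.single t 1 * p) k =
      (\<Sum>m\<in>Poly_Mapping.keys p. if t + m = k then Poly_Mapping.lookup p m else 0)" for k
    by (simp add: lookup_sum lookup_single when_def)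
  then have lookup: "Poly_Mapping.lookup (Poly_Mapping.single t 1 * p) (t + m) =
      Poly_Mapping.lookup p m" for m
    by (simp add: in_keys_iff)
  have "Poly_Mapping.keys (Poly_Mapping.single t 1 * p) \<subseteq> (+) t ` Poly_Mapping.keys p"
    using keys_mult[of "Poly_Mapping.single t 1" p] by auto
  with lookup show ?thesis by (auto simp: in_keys_iff)
qed

text \<open>Membership is decided term by term: the right-hand side is a submodule containing the
  generators, and each term of its members is a multiple of a generator.\<close>

lemma ideal_gen_monom:
  "ideal_gen (monom ` M) = {p. Poly_Mapping.keys p \<subseteq> {s + t | s t. t \<in> M}}"
    (is "_ = {p. _ \<subseteq> ?U}")
proof
  interpret poly_module: module "(*) :: 'a zpoly \<Rightarrow> _" by (rule module_zpoly)
  show "ideal_gen (monom ` M) \<subseteq> {p. Poly_Mapping.keys p \<subseteq> ?U}"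
    unfolding ideal_gen_def
  proof (rule poly_module.span_minimal)
    show "monom ` M \<subseteq> {p. Poly_Mapping.keys p \<subseteq> ?U}"
      by (auto simp: monom_def) (metis add_0)
    have scale: "Poly_Mapping.keys (c * p) \<subseteq> ?U" if p: "Poly_Mapping.keys p \<subseteq> ?U" for c p :: "'a zpoly"
    proof
      fix k assume "k \<in> Poly_Mapping.keys (c * p)"
      then obtain u v where "k = u + v" "v \<in> Poly_Mapping.keys p" using keys_mult[of c p] by blast
      moreover then obtain s t where "v = s + t" "t \<in> M" using p by blast
      ultimately have "k = (u + s) + t" by (simp add: add.assoc)
      with \<open>t \<in> M\<close> show "k \<in> ?U" by blast
    qed
    have add: "Poly_Mapping.keys (p + q) \<subseteq> ?U"
      if "Poly_Mapping.keys p \<subseteq> ?U" "Poly_Mapping.keys q \<subseteq> ?U" for p q :: "'a zpoly"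
      using keys_add[of p q] that by (meson le_sup_iff order_trans)
    show "poly_module.subspace {p. Poly_Mapping.keys p \<subseteq> ?U}"
    proof (rule poly_module.subspaceI, goal_cases)
      case 1
      show ?case by simp
    next
      case (2 p q)
      then show ?case unfolding mem_Collect_eq by (rule add)
    next
      case (3 c p)
      then show ?case unfolding mem_Collect_eq by (rule scale)
    qed
  qed
  show "{p. Poly_Mapping.keys p \<subseteq> ?U} \<subseteq> ideal_gen (monom ` M)"
  proof clarify
    fix p :: "'a zpoly" assume p: "Poly_Mapping.keys p \<subseteq> ?U"
    have "Poly_Mapping.single m (Poly_Mapping.lookup p m) \<in> ideal_gen (monom ` M)"
      if "m \<in> Poly_Mapping.keys p" for m
    proof -
      have "m \<in> ?U" using p that by blast
      then obtain s t where m: "m = s + t" "t \<in> M" by blast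
      have "Poly_Mapping.single m (Poly_Mapping.lookup p m) =
          Poly_Mapping.single s (Poly_Mapping.lookup p m) * monom t"
        by (simp add: m monom_def mult_single)
      then show ?thesis
        unfolding ideal_gen_def using m(2)
        by (simp add: poly_module.span_scale poly_module.span_base)
    qed
    then show "p \<in> ideal_gen (monom ` M)"
      unfolding ideal_gen_def by (subst poly_sum_single) (rule poly_module.span_sum)
  qed
qed

text \<open>The first disjunct accounts for the squares of the variables; any other monomial is
  squarefree, hence given by its support.\<close>

definition nonface_mons :: "'x set set \<Rightarrow> 'x mon set" where
  "nonface_mons N = {m. (\<exists>x. 2 \<le> Poly_Mapping.lookup m x) \<or> Poly_Mapping.keys m \<in> N}"

definition nonface_ideal :: "'x set set \<Rightarrow> 'x zpoly set" where
  "nonface_ideal N = {p. Poly_Mapping.keys p \<subseteq> nonface_mons N}"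

lemma nonface_mons_add:
  assumes "up_closed N" "t \<in> nonface_mons N"
  shows "s + t \<in> nonface_mons N"
proof -
  have "2 \<le> Poly_Mapping.lookup (s + t) x" if "2 \<le> Poly_Mapping.lookup t x" for x
    using that by (simp add: lookup_add)
  moreover have "Poly_Mapping.keys (s + t) \<in> N" if "Poly_Mapping.keys t \<in> N"
    using up_closedD[OF assms(1) that] by (simp add: keys_add_nat)
  ultimately show ?thesis using assms(2) by (auto simp: nonface_mons_def)
qed

lemma nonface_ideal_gen:
  assumes "up_closed N"
  shows "nonface_ideal N = ideal_gen (monom ` nonface_mons N)"
proof -
  have "{s + t | s t. t \<in> nonface_mons N} = nonface_mons N"
    using nonface_mons_add[OF assms] by (auto, metis add_0)
  then show ?thesis by (simp add: ideal_gen_monom nonface_ideal_def)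
qed

lemma monomial_ideal_nonface:
  fixes I :: "'x zpoly set"
  assumes "monomial_ideal I" "\<And>x. (var x)\<^sup>2 \<in> I"
  obtains N where "up_closed N" "I = nonface_ideal N"
proof -
  obtain M where M: "I = ideal_gen (monom ` M)"
    using assms(1) by (auto simp: monomial_ideal_def)
  define U where "U = {s + t | s t. t \<in> M}"
  have I: "I = {p. Poly_Mapping.keys p \<subseteq> U}"
    by (simp add: M ideal_gen_monom U_def)
  \<comment> \<open>\<open>U\<close> is closed under multiples; the truncated difference
    \<open>m - t\<close> is exact because \<open>t\<close> divides \<open>m\<close>.\<close>
  have U_le: "m \<in> U" if t: "t \<in> U" "\<And>x. Poly_Mapping.lookup t x \<le> Poly_Mapping.lookup m x" for t m
  proof -
    obtain r q where rq: "t = r + q" "q \<in> M" using t(1) by (auto simp: U_def)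
    have "m = (m - t) + t"
      using t(2) by (intro poly_mapping_eqI) (simp add: lookup_add minus_poly_mapping.rep_eq)
    then have "m = (m - t + r) + q" by (simp add: rq add.assoc)
    then show ?thesis using rq(2) unfolding U_def by blast
  qed
  have "(var x)\<^sup>2 = Poly_Mapping.single (Poly_Mapping.single x 2) 1" for x :: 'x
    by (simp add: power2_eq_square var_def monom_def mult_single single_add[symmetric]
        numeral_2_eq_2)
  then have sq: "Poly_Mapping.single x 2 \<in> U" for x
    using assms(2)[of x] by (simp add: I)
  \<comment> \<open>Taking all supersets of supports of squarefree members makes \<open>N\<close>
    up-closed by construction.\<close>
  define N where "N = {F. \<exists>m\<in>U. Poly_Mapping.keys m \<subseteq> F \<and> (\<forall>x. Poly_Mapping.lookup m x \<le> 1)}"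
  have "U = nonface_mons N"
  proof (intro equalityI subsetI)
    fix m assume m: "m \<in> U"
    show "m \<in> nonface_mons N"
    proof (cases "\<exists>x. 2 \<le> Poly_Mapping.lookup m x")
      case False
      then have "Poly_Mapping.lookup m x \<le> 1" for x by (metis not_less_eq_eq numeral_2_eq_2 One_nat_def)
      with m show ?thesis by (auto simp: nonface_mons_def N_def)
    qed (simp add: nonface_mons_def)
  next
    fix m assume "m \<in> nonface_mons N"
    then consider x where "2 \<le> Poly_Mapping.lookup m x" | "Poly_Mapping.keys m \<in> N"
      by (auto simp: nonface_mons_def)
    then show "m \<in> U"
    proof cases
      case 1
      then show ?thesis by (intro U_le[OF sq[of x]]) (auto simp: lookup_single when_def)
    next
      case 2
      then obtain t where t: "t \<in> U" "Poly_Mapping.keys t \<subseteq> Poly_Mapping.keys m"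
        "\<And>x. Poly_Mapping.lookup t x \<le> 1" by (auto simp: N_def)
      have "Poly_Mapping.lookup t x \<le> Poly_Mapping.lookup m x" for x
      proof (cases "x \<in> Poly_Mapping.keys t")
        case True
        then have "Poly_Mapping.lookup m x \<noteq> 0" using t(2) by (auto simp only: in_keys_iff)
        then show ?thesis using t(3)[of x] by linarith
      qed (simp add: in_keys_iff)
      with t(1) show ?thesis by (rule U_le)
    qed
  qed
  moreover have "up_closed N" by (auto simp: up_closed_def N_def)
  ultimately show thesis using that I by (auto simp: nonface_ideal_def)
qed

section \<open>Translating ideal operations into operations on families\<close>

lemma monom_in_nonface_ideal: "monom m \<in> nonface_ideal N \<longleftrightarrow> m \<in> nonface_mons N"
  by (simp add: nonface_ideal_def monom_def)

lemma indicator_mon: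
  fixes F :: "'x::finite set"
  obtains m :: "'x mon" where "Poly_Mapping.keys m = F" "\<And>x. Poly_Mapping.lookup m x \<le> 1"
proof -
  let ?m = "Abs_poly_mapping (\<lambda>x. if x \<in> F then 1 else 0 :: nat)"
  have "Poly_Mapping.lookup ?m = (\<lambda>x. if x \<in> F then 1 else 0)" by simp
  then have "Poly_Mapping.keys ?m = F" "\<And>x. Poly_Mapping.lookup ?m x \<le> 1"
    by (auto simp: in_keys_iff split: if_splits)
  then show thesis by (rule that)
qed

text \<open>A squarefree monomial with support \<open>F\<close> tests whether \<open>F\<close>
  belongs to the family.\<close>

lemma nonface_ideal_inject:
  fixes N N' :: "'x::finite set set"
  shows "nonface_ideal N = nonface_ideal N' \<longleftrightarrow> N = N'"
proof
  assume eq: "nonface_ideal N = nonface_ideal N'"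
  have "F \<in> N \<longleftrightarrow> F \<in> N'" for F
  proof -
    obtain m :: "'x mon" where m: "Poly_Mapping.keys m = F" "\<And>x. Poly_Mapping.lookup m x \<le> 1"
      using indicator_mon[of F] by blast
    have "\<not> 2 \<le> Poly_Mapping.lookup m x" for x
      using m(2)[of x] by linarith
    with m(1) have "m \<in> nonface_mons K \<longleftrightarrow> F \<in> K" for K
      by (simp add: nonface_mons_def)
    with eq show ?thesis using monom_in_nonface_ideal by metis
  qed
  then show "N = N'" by blast
qed simp

lemma var_in_nonface_ideal: "var a \<in> nonface_ideal N \<longleftrightarrow> {a} \<in> N"
  by (auto simp: var_def monom_in_nonface_ideal nonface_mons_def lookup_single when_def)

text \<open>Multiplying by the variable creates a new square exactly when it already divides the
  monomial; this is the disjunct \<open>a \<in> F\<close> in \<open>link\<close>.\<close>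

lemma colon_nonface_ideal: "colon (nonface_ideal N) (var a) = nonface_ideal (link N a)"
proof -
  have "Poly_Mapping.single a 1 + m \<in> nonface_mons N \<longleftrightarrow> m \<in> nonface_mons (link N a)" for m
  proof -
    have "(\<exists>x. 2 \<le> Poly_Mapping.lookup (Poly_Mapping.single a 1 + m) x) \<longleftrightarrow>
        a \<in> Poly_Mapping.keys m \<or> (\<exists>x. 2 \<le> Poly_Mapping.lookup m x)"
      by (force simp: lookup_add lookup_single when_def in_keys_iff)
    then show ?thesis by (auto simp: nonface_mons_def link_def keys_add_nat)
  qed
  then show ?thesis
    by (auto simp: colon_def nonface_ideal_def var_def monom_def keys_single_mult)
qed

lemma adjoin_nonface_ideal:
  fixes N :: "'x set set"
  assumes "up_closed N"
  shows "adjoin (nonface_ideal N) (var a) = nonface_ideal {F. a \<in> F \<or> F \<in> N}"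
proof -
  interpret poly_module: module "(*) :: 'x zpoly \<Rightarrow> _" by (rule module_zpoly)
  let ?N = "{F. a \<in> F \<or> F \<in> N}" and ?a = "Poly_Mapping.single a 1 :: 'x mon"
  have "adjoin (nonface_ideal N) (var a) = ideal_gen (monom ` insert ?a (nonface_mons N))"
  proof -
    \<comment> \<open>Adjoining to a span only adds a generator, so the result is again generated by
      monomials.\<close>
    have "poly_module.span (insert f (poly_module.span S)) = poly_module.span (insert f S)"
      for f and S :: "'x zpoly set"
      by (auto simp: poly_module.span_eq intro: poly_module.span_base
        poly_module.span_mono[of S, THEN subsetD])
    then show ?thesis
      by (simp add: adjoin_def nonface_ideal_gen[OF assms] ideal_gen_def var_def)
  qed
  also have "\<dots> = nonface_ideal ?N"
  proof -
    have "m \<in> {s + t | s t. t \<in> insert ?a (nonface_mons N)} \<longleftrightarrow> m \<in> nonface_mons ?N" for m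
    proof
      assume "m \<in> {s + t | s t. t \<in> insert ?a (nonface_mons N)}"
      then consider s where "m = s + ?a" | "m \<in> nonface_mons N"
        using nonface_mons_add[OF assms] by auto
      then show "m \<in> nonface_mons ?N" by cases (auto simp: nonface_mons_def keys_add_nat)
    next
      assume "m \<in> nonface_mons ?N"
      then consider "a \<in> Poly_Mapping.keys m" | "m \<in> nonface_mons N"
        by (auto simp: nonface_mons_def)
      then show "m \<in> {s + t | s t. t \<in> insert ?a (nonface_mons N)}"
      proof cases
        case 1
        then have "m = (m - ?a) + ?a"
          by (intro poly_mapping_eqI)
            (auto simp: lookup_add minus_poly_mapping.rep_eq lookup_single when_def in_keys_iff)
        then show ?thesis by blast
      next
        case 2
        have "m = 0 + m" by simp
        with 2 show ?thesis by blast
      qed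
    qed
    then show ?thesis unfolding ideal_gen_monom nonface_ideal_def by blast
  qed
  finally show ?thesis .
qed

lemma cone_apex_nonface_ideal:
  fixes N :: "'x::finite set set"
  assumes up: "up_closed N"
  shows "cone_apex (nonface_ideal N) a \<longleftrightarrow> cone N a"
proof -
  have "cone_apex (nonface_ideal N) a \<longleftrightarrow> link N a = {F. a \<in> F \<or> F \<in> N}"
    by (simp add: cone_apex_def colon_nonface_ideal adjoin_nonface_ideal[OF up]
        nonface_ideal_inject)
  also have "\<dots> \<longleftrightarrow> cone N a"
    using up_closedD[OF up] unfolding link_def cone_def
    by (safe; metis (no_types, lifting) insert_absorb mem_Collect_eq subset_insertI)
  finally show ?thesis .
qed

lemma dominates_nonface_ideal:
  fixes N :: "'x::finite set set"
  assumes up: "up_closed N"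
  shows "dominates (nonface_ideal N) a b \<longleftrightarrow> dominating N a b"
proof -
  let ?D = "{F. a \<in> F \<or> F \<in> N}"
  have "up_closed ?D" using up by (auto simp: up_closed_def)
  then have *: "dominates (nonface_ideal N) a b \<longleftrightarrow> \<not> cone N b \<and> cone ?D b"
    by (simp add: dominates_def adjoin_nonface_ideal[OF up] cone_apex_nonface_ideal up)
  show ?thesis
  proof (cases "a = b")
    case True
    \<comment> \<open>For \<open>a = b\<close> every set containing \<open>b\<close> lies in
      \<open>?D\<close>, so an apex forces the empty set, and with it every set, into
      \<open>N\<close>.\<close>
    have "cone N b" if "cone ?D b"
    proof -
      from that have "{} \<in> ?D" unfolding cone_def using True by blast
      then have "{} \<in> N" by simp
      then show ?thesis using up_closedD[OF up] by (auto simp: cone_def)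
    qed
    with * True show ?thesis by (auto simp: dominating_def)
  next
    case False
    then show ?thesis unfolding * dominating_def by (auto simp: cone_def)
  qed
qed

section \<open>Resolutions as iterated links\<close>

lemma stage_0 [simp]: "stage I A 0 = I"
  by (simp add: stage_def colon_def)

text \<open>Successive colon ideals compose, which turns the indexed definition into recursion on
  the list.\<close>

lemma stage_Cons [simp]: "stage I (a # A) (Suc i) = stage (colon I (var a)) A i"
  by (simp add: stage_def colon_def mult.assoc)

lemma resolution_Cons:
  "resolution I (a # A) \<longleftrightarrow>
    var a \<notin> I \<and> (cone_apex I a \<or> (\<exists>b. dominates I a b)) \<and> resolution (colon I (var a)) A"
  by (simp add: resolution_def All_less_Suc2)

context
  fixes N :: "'x::finite set set"
  assumes up: "up_closed N"
begin

lemma resolution_nonface_ideal: "resolution (nonface_ideal N) A \<longleftrightarrow> res N A"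
  using up
proof (induction A arbitrary: N)
  case Nil
  then show ?case by (simp add: resolution_def)
next
  case (Cons a A)
  then show ?case
    by (simp add: resolution_Cons step_def colon_nonface_ideal up_closed_link var_in_nonface_ideal
        cone_apex_nonface_ideal dominates_nonface_ideal)
qed

lemma spherical_nonface_ideal:
  "spherical_resolution (nonface_ideal N) A \<longleftrightarrow> res N A \<and> cone_free N A"
proof -
  have "(\<forall>i<length A. \<not> cone_apex (stage (nonface_ideal N) A i) (A ! i)) \<longleftrightarrow> cone_free N A"
    using up
    by (induction A arbitrary: N)
      (simp_all add: All_less_Suc2 colon_nonface_ideal up_closed_link cone_apex_nonface_ideal)
  then show ?thesis by (simp add: spherical_resolution_def resolution_nonface_ideal)
qed

lemma maximal_nonface_ideal: "maximal_resolution (nonface_ideal N) A \<longleftrightarrow> max_res N A"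
proof -
  have "res N A \<and> (\<forall>a. \<not> res N (A @ [a])) \<longleftrightarrow> max_res N A"
    by (induction A arbitrary: N) auto
  then show ?thesis by (simp add: maximal_resolution_def resolution_nonface_ideal)
qed

end

lemma core_nonface_ideal: "core (nonface_ideal N) A = nonface_ideal (links N A)"
proof (induction A arbitrary: N)
  case Nil
  then show ?case by (simp add: core_def)
next
  case (Cons a A)
  then show ?case by (simp add: core_def colon_nonface_ideal)
qed

text \<open>\<open>permute_vars\<close> pulls back along \<open>map_key\<close>, so the left ideal
  is first identified as a preimage of the right one; surjectivity then yields the image.\<close>

lemma permute_nonface_ideal:
  assumes "bij \<sigma>"
  shows "permute_vars \<sigma> ` nonface_ideal N = nonface_ideal (act \<sigma> N)"
proof -
  have bij': "bij (inv \<sigma>)" using assms by (rule bij_imp_bij_inv)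
  have mons: "Poly_Mapping.map_key \<sigma> m \<in> nonface_mons N \<longleftrightarrow> m \<in> nonface_mons (act \<sigma> N)" for m
  proof -
    have "Poly_Mapping.keys m = \<sigma> ` Poly_Mapping.keys (Poly_Mapping.map_key \<sigma> m)"
      by (simp only: keys_map_key[OF bij_is_inj[OF assms]]
          surj_image_vimage_eq[OF bij_is_surj[OF assms]])
    then have "Poly_Mapping.keys m \<in> act \<sigma> N \<longleftrightarrow> Poly_Mapping.keys (Poly_Mapping.map_key \<sigma> m) \<in> N"
      by (simp only: image_mem_act[OF assms])
    moreover have "(\<exists>x. 2 \<le> Poly_Mapping.lookup (Poly_Mapping.map_key \<sigma> m) x) \<longleftrightarrow>
        (\<exists>x. 2 \<le> Poly_Mapping.lookup m x)"
      unfolding map_key.rep_eq[OF bij_is_inj[OF assms]] comp_apply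
      using surjD[OF bij_is_surj[OF assms]] by metis
    ultimately show ?thesis by (simp add: nonface_mons_def)
  qed
  have cancel: "Poly_Mapping.map_key \<tau> (Poly_Mapping.map_key \<rho> m) = m"
    if "bij \<tau>" "bij \<rho>" "\<rho> \<circ> \<tau> = id" for \<tau> \<rho> and m :: "'a mon"
    using that by (simp add: map_key_compose bij_is_inj map_key_id[unfolded id_def[symmetric]])
  have keys: "Poly_Mapping.keys (permute_vars \<sigma> p) =
      Poly_Mapping.map_key \<sigma> -` Poly_Mapping.keys p" for p
    unfolding permute_vars_def by (rule keys_map_key[OF inj_map_key_bij[OF assms]])
  have surj: "\<exists>k. Poly_Mapping.map_key \<sigma> k = m" for m :: "'a mon"
    using cancel[OF assms bij' inv_o_cancel[OF bij_is_inj[OF assms]]] by blast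
  have mem: "permute_vars \<sigma> p \<in> nonface_ideal (act \<sigma> N) \<longleftrightarrow> p \<in> nonface_ideal N" for p
  proof -
    have "permute_vars \<sigma> p \<in> nonface_ideal (act \<sigma> N) \<longleftrightarrow>
        (\<forall>m. Poly_Mapping.map_key \<sigma> m \<in> Poly_Mapping.keys p \<longrightarrow>
             Poly_Mapping.map_key \<sigma> m \<in> nonface_mons N)"
      by (auto simp: nonface_ideal_def keys mons)
    also have "\<dots> \<longleftrightarrow> p \<in> nonface_ideal N"
      unfolding nonface_ideal_def mem_Collect_eq subset_iff using surj by metis
    finally show ?thesis .
  qed
  have "q \<in> range (permute_vars \<sigma>)" for q :: "'a zpoly"
  proof
    have eq: "Poly_Mapping.map_key (inv \<sigma>) \<circ> Poly_Mapping.map_key \<sigma> = (\<lambda>m :: 'a mon. m)"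
      using cancel[OF bij' assms iffD1[OF surj_iff bij_is_surj[OF assms]]]
      by (simp only: fun_eq_iff comp_apply) blast
    show "q = permute_vars \<sigma> (permute_vars (inv \<sigma>) q)"
      unfolding permute_vars_def
        map_key_compose[OF inj_map_key_bij[OF assms] inj_map_key_bij[OF bij']] eq map_key_id ..
  qed simp
  then have "surj (permute_vars \<sigma> :: 'a zpoly \<Rightarrow> _)" by blast
  moreover have "nonface_ideal N = permute_vars \<sigma> -` nonface_ideal (act \<sigma> N)"
    by (simp only: set_eq_iff vimage_eq mem simp_thms)
  ultimately show ?thesis by (simp only: surj_image_vimage_eq)
qed

theorem theorem4p10:
  fixes I :: "'x::finite zpoly set"
  assumes "monomial_ideal I"
    and "\<And>x. (var x)\<^sup>2 \<in> I"
    and "spherical_ideal I"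
  shows "(\<forall>A. resolution I A \<longrightarrow> spherical_resolution I A) \<and>
    (\<forall>A A'. maximal_resolution I A \<and> maximal_resolution I A' \<longrightarrow> depth A = depth A') \<and>
    (\<forall>A A'. maximal_resolution I A \<and> maximal_resolution I A' \<longrightarrow>
       (\<exists>\<sigma>. bij \<sigma> \<and> core I A = permute_vars \<sigma> ` core I A'))"
proof -
  obtain N where up: "up_closed N" and I: "I = nonface_ideal N"
    using monomial_ideal_nonface[OF assms(1,2)] by blast
  note to_N = I resolution_nonface_ideal[OF up] spherical_nonface_ideal[OF up]
    maximal_nonface_ideal[OF up] core_nonface_ideal
  obtain S where "max_res N S" "cone_free N S"
    using assms(3) unfolding spherical_ideal_def to_N by blast
  note S = spherical_confluence[OF up this]
  have cone_free: "cone_free N A" if "res N A" for A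
    using S[of A] that by blast
  \<comment> \<open>Taking \<open>A'\<close>, itself spherical by \<open>cone_free\<close>, as the
    reference gives the permutation directly, without a detour through \<open>S\<close>.\<close>
  have confluent: "length A = length A' \<and> (\<exists>\<sigma>. bij \<sigma> \<and> links N A = act \<sigma> (links N A'))"
    if "max_res N A \<and> max_res N A'" for A A'
    using spherical_confluence[OF up conjunct2[OF that]
        cone_free[OF max_res_imp_res[OF conjunct2[OF that]]], of A] that
    by blast
  have core: "\<exists>\<sigma>. bij \<sigma> \<and> nonface_ideal (links N A) = permute_vars \<sigma> ` nonface_ideal (links N A')"
    if max: "max_res N A \<and> max_res N A'" for A A'
  proof -
    obtain \<sigma> where "bij \<sigma>" "links N A = act \<sigma> (links N A')"
      using confluent[OF max] by blast
    then show ?thesis using permute_nonface_ideal[of \<sigma> "links N A'"] by metis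
  qed
  show ?thesis
    unfolding to_N depth_def
    by (intro conjI allI impI; (elim conjunct1[OF confluent] core cone_free)?)
qed

end
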